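(* For every positive integer $k$, there exist infinitely many (pairwise non-isomorphic) finite non-abelian groups $G$ such that $k\le\kappa(\Gamma_G)$ (so that $\mathrm{rc}_k(\Gamma_G)$ is defined) and $\mathrm{rc}_k(\Gamma_G)=2$, where $\Gamma_G$ is the non-commuting graph of $G$.
   Context: For a non-abelian group $G$ with center $Z(G)$, the non-commuting graph $\Gamma_G$ is the simple graph with vertex set $G\setminus Z(G)$ in which two distinct vertices $x,y$ are adjacent if and only if $xy\neq yx$. Let $\Gamma$ be a connected finite simple graph. Its vertex connectivity $\kappa(\Gamma)$ is the smallest number of vertices whose deletion disconnects $\Gamma$. An edge coloring of $\Gamma$ is an arbitrary assignment of colors to the edges (adjacent edges may receive the same color). Given an edge coloring, a path is rainbow if no two of its edges have the same color. For a positive integer $k\le\kappa(\Gamma)$, an edge-colored graph $\Gamma$ is rainbow-$k$-connected if any two distinct vertices of $\Gamma$ are connected by at least $k$ (distinct) internally disjoint rainbow paths (a single edge counts as a rainbow path). The rainbow-$k$-connectivity $\mathrm{rc}_k(\Gamma)$ is the minimum number of colors required to color the edges of $\Gamma$ so that it becomes rainbow-$k$-connected. *)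

theory Defs
  imports "HOL-Algebra.Group" "Graph_Theory.Graph_Theory"
begin

text \<open>
  A simple graph is a pair digraph whose arc relation is symmetric and irreflexive; an undirected
  edge between \<open>x\<close> and \<open>y\<close> is then represented by both arcs \<open>(x, y)\<close> and \<open>(y, x)\<close>.
\<close>

definition group_center :: "('a, 'b) monoid_scheme \<Rightarrow> 'a set" where
  "group_center G = {z \<in> carrier G. \<forall>x \<in> carrier G. z \<otimes>\<^bsub>G\<^esub> x = x \<otimes>\<^bsub>G\<^esub> z}"

definition non_commuting_graph :: "('a, 'b) monoid_scheme \<Rightarrow> 'a pair_pre_digraph" where
  "non_commuting_graph G =
     \<lparr> pverts = carrier G - group_center G,
       parcs = {(x, y). x \<in> carrier G - group_center G \<and> y \<in> carrier G - group_center G \<and>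
                        x \<noteq> y \<and> x \<otimes>\<^bsub>G\<^esub> y \<noteq> y \<otimes>\<^bsub>G\<^esub> x} \<rparr>"

lemma pair_graph_non_commuting_graph:
  assumes "finite (carrier G)"
  shows "pair_graph (non_commuting_graph G)"
proof
  show "finite (pverts (non_commuting_graph G))"
    using assms by (simp add: non_commuting_graph_def)
  have "parcs (non_commuting_graph G) \<subseteq> carrier G \<times> carrier G"
    by (auto simp: non_commuting_graph_def)
  then show "finite (parcs (non_commuting_graph G))"
    using assms by (meson finite_SigmaI finite_subset)
  show "symmetric (with_proj (non_commuting_graph G))"
    by (auto simp: symmetric_def sym_def non_commuting_graph_def)
qed (auto simp: non_commuting_graph_def)

text \<open>
  The second disjunct only matters for complete graphs, which no set of vertices disconnects: it
  is the usual convention giving the complete graph on \<open>n\<close> vertices connectivity \<open>n - 1\<close>. In any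
  other graph some deletion disconnects, and a smallest disconnecting set is smaller than any set
  that leaves at most one vertex. In the library the graph without vertices is not connected.
\<close>

definition vertex_connectivity :: "'a pair_pre_digraph \<Rightarrow> nat" where
  "vertex_connectivity \<Gamma> =
     Inf {card S | S. S \<subseteq> pverts \<Gamma> \<and>
       (\<not> connected (with_proj \<Gamma> \<restriction> (pverts \<Gamma> - S)) \<or> card (pverts \<Gamma> - S) \<le> 1)}"

definition edges :: "'a pair_pre_digraph \<Rightarrow> 'a set set" where
  "edges \<Gamma> = {{x, y} | x y. (x, y) \<in> parcs \<Gamma>}"

text \<open>
  Colorings are functions on unordered pairs, so that both arcs of an edge get the same color;
  only their values on \<^const>\<open>edges\<close> matter. Natural numbers as colors suffice for finite graphs.
\<close>

definition rainbow_path ::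
  "'a pair_pre_digraph \<Rightarrow> ('a set \<Rightarrow> nat) \<Rightarrow> 'a \<Rightarrow> 'a vwalk \<Rightarrow> 'a \<Rightarrow> bool" where
  "rainbow_path \<Gamma> c u p v \<longleftrightarrow>
     vpath p (with_proj \<Gamma>) \<and> hd p = u \<and> last p = v \<and>
     distinct (map (\<lambda>(x, y). c {x, y}) (vwalk_arcs p))"

definition rainbow_k_connected ::
  "nat \<Rightarrow> 'a pair_pre_digraph \<Rightarrow> ('a set \<Rightarrow> nat) \<Rightarrow> bool" where
  "rainbow_k_connected k \<Gamma> c \<longleftrightarrow>
     (\<forall>u \<in> pverts \<Gamma>. \<forall>v \<in> pverts \<Gamma>. u \<noteq> v \<longrightarrow>
       (\<exists>P. finite P \<and> k \<le> card P \<and>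
            (\<forall>p \<in> P. rainbow_path \<Gamma> c u p v) \<and>
            (\<forall>p \<in> P. \<forall>q \<in> P. p \<noteq> q \<longrightarrow> set p \<inter> set q = {u, v})))"

text \<open>
  Only meaningful for \<open>k \<le> vertex_connectivity \<Gamma>\<close>; the infimum of the empty set of naturals is 0.
\<close>

definition rainbow_connectivity :: "nat \<Rightarrow> 'a pair_pre_digraph \<Rightarrow> nat" where
  "rainbow_connectivity k \<Gamma> = Inf {card (c ` edges \<Gamma>) | c. rainbow_k_connected k \<Gamma> c}"

end

theory Submission
  imports Defs "HOL-Number_Theory.Cong"
begin

text \<open>
  In the dihedral group of order \<open>2n\<close> with \<open>n = m\<^sup>2\<close> odd, the center is trivial and two non-central
  elements commute only if they are equal or both rotations. So every reflection is adjacent to all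
  other vertices of the non-commuting graph, which makes the graph highly connected. Rotations and
  reflections are both labelled by the cells of an \<open>m \<times> m\<close> board. A pair of reflections is colored
  by whether the two cells share a row or column, and a rotation-reflection pair by the negation
  of this. Then for any two vertices some line of the board carries at least \<open>m - 2\<close> reflections
  that are joined to the two vertices by edges of different colors, giving \<open>m - 2\<close> internally
  disjoint rainbow paths of length 2. One color is not enough, because two rotations are not adjacent.
\<close>

section \<open>Vertex connectivity of graphs with many dominating vertices\<close>

lemma connected_if_dominating_vertex:
  assumes "d \<in> verts G"
    and dom: "\<And>x. x \<in> verts G \<Longrightarrow> x \<noteq> d \<Longrightarrow> (x, d) \<in> arcs_ends G"
  shows "connected G"
  unfolding connected_def strongly_connected_def
proof (intro conjI ballI)
  let ?R = "rtrancl_on (verts G) (parcs (mk_symmetric G))"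
  have sym: "(x, y) \<in> parcs (mk_symmetric G) \<and> (y, x) \<in> parcs (mk_symmetric G)"
    if "(x, y) \<in> arcs_ends G" for x y
    using that by (auto simp: parcs_mk_symmetric arcs_ends_conv)
  have "(x, d) \<in> ?R \<and> (d, x) \<in> ?R" if "x \<in> verts G" for x
    using assms(1) that sym[OF dom[OF that]]
    by (cases "x = d") (auto intro: rtrancl_on_into_rtrancl_on[OF rtrancl_on_refl])
  then show "x \<rightarrow>\<^sup>*\<^bsub>mk_symmetric G\<^esub> y"
    if "x \<in> verts (mk_symmetric G)" "y \<in> verts (mk_symmetric G)" for x y
    using that unfolding reachable_def by (auto intro: rtrancl_on_trans[of x d _ _ y])
  show "verts (mk_symmetric G) \<noteq> {}"
    using assms(1) by auto
qed

text \<open>Deleting fewer than \<open>k\<close> vertices spares at least two members of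
  \<open>D\<close>: one of them keeps the rest connected, and two exclude the case of at most one
  remaining vertex.\<close>

lemma vertex_connectivity_ge_if_dominating_set:
  assumes fin: "finite (pverts \<Gamma>)" and "D \<subseteq> pverts \<Gamma>" and "k < card D"
    and dom: "\<And>x d. d \<in> D \<Longrightarrow> x \<in> pverts \<Gamma> \<Longrightarrow> x \<noteq> d \<Longrightarrow> (x, d) \<in> parcs \<Gamma>"
  shows "k \<le> vertex_connectivity \<Gamma>"
  unfolding vertex_connectivity_def
proof (rule cInf_greatest)
  let ?X = "{card S | S. S \<subseteq> pverts \<Gamma> \<and>
       (\<not> connected (with_proj \<Gamma> \<restriction> (pverts \<Gamma> - S)) \<or> card (pverts \<Gamma> - S) \<le> 1)}"
  have "card (pverts \<Gamma>) \<in> ?X"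
    by auto
  then show "?X \<noteq> {}"
    by blast
  fix s assume "s \<in> ?X"
  then obtain S where S: "s = card S" "S \<subseteq> pverts \<Gamma>"
    "\<not> connected (with_proj \<Gamma> \<restriction> (pverts \<Gamma> - S)) \<or> card (pverts \<Gamma> - S) \<le> 1"
    by blast
  show "k \<le> s"
  proof (rule ccontr)
    assume "\<not> k \<le> s"
    have finS: "finite S"
      using S(2) fin by (rule finite_subset)
    have two: "2 \<le> card (D - S)"
      using diff_card_le_card_Diff[OF finS, of D] \<open>\<not> k \<le> s\<close> \<open>k < card D\<close> S(1) by linarith
    then obtain d where d: "d \<in> D" "d \<notin> S"
      by (metis Diff_iff card.empty equals0I not_numeral_le_zero)
    have "connected (with_proj \<Gamma> \<restriction> (pverts \<Gamma> - S))"
      by (rule connected_if_dominating_vertex[of d])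
         (use d dom \<open>D \<subseteq> pverts \<Gamma>\<close> in \<open>auto simp: arcs_ends_conv\<close>)
    moreover have "card (D - S) \<le> card (pverts \<Gamma> - S)"
      using fin \<open>D \<subseteq> pverts \<Gamma>\<close> by (intro card_mono) auto
    ultimately show False
      using S(3) two by linarith
  qed
qed

section \<open>Rainbow paths of length two, and a criterion for rainbow connectivity 2\<close>

lemma rainbow_path_via:
  assumes "(u, w) \<in> parcs \<Gamma>" "(w, v) \<in> parcs \<Gamma>" "{u, v, w} \<subseteq> pverts \<Gamma>"
    and "u \<noteq> v" "w \<noteq> u" "w \<noteq> v" "c {u, w} \<noteq> c {w, v}"
  shows "rainbow_path \<Gamma> c u [u, w, v] v"
  using assms by (auto simp: rainbow_path_def vpath_def vwalk_def arcs_ends_conv)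

text \<open>Two-edge paths with different middle vertices are internally disjoint, so counting paths
  reduces to counting middle vertices.\<close>

lemma rainbow_k_connected_via:
  assumes "\<And>u v. u \<in> pverts \<Gamma> \<Longrightarrow> v \<in> pverts \<Gamma> \<Longrightarrow> u \<noteq> v \<Longrightarrow>
    \<exists>W. finite W \<and> k \<le> card W \<and> u \<notin> W \<and> v \<notin> W \<and> (\<forall>w\<in>W. rainbow_path \<Gamma> c u [u, w, v] v)"
  shows "rainbow_k_connected k \<Gamma> c"
  unfolding rainbow_k_connected_def
proof (intro ballI impI)
  fix u v assume "u \<in> pverts \<Gamma>" "v \<in> pverts \<Gamma>" "u \<noteq> v"
  then obtain W where W: "finite W" "k \<le> card W" "u \<notin> W" "v \<notin> W"
    "\<And>w. w \<in> W \<Longrightarrow> rainbow_path \<Gamma> c u [u, w, v] v"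
    using assms by meson
  have "card ((\<lambda>w. [u, w, v]) ` W) = card W"
    by (rule card_image) (simp add: inj_on_def)
  then show "\<exists>P. finite P \<and> k \<le> card P \<and> (\<forall>p\<in>P. rainbow_path \<Gamma> c u p v) \<and>
      (\<forall>p\<in>P. \<forall>q\<in>P. p \<noteq> q \<longrightarrow> set p \<inter> set q = {u, v})"
    using W by (intro exI[of _ "(\<lambda>w. [u, w, v]) ` W"]) auto
qed

text \<open>A rainbow path between non-adjacent vertices has at least two edges, and its first two
  edges already differ in color.\<close>

lemma two_colors_if_rainbow_connected:
  assumes "k > 0" and fin: "finite (parcs \<Gamma>)"
    and uv: "u \<in> pverts \<Gamma>" "v \<in> pverts \<Gamma>" "u \<noteq> v" "(u, v) \<notin> parcs \<Gamma>"
    and c: "rainbow_k_connected k \<Gamma> c"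
  shows "2 \<le> card (c ` edges \<Gamma>)"
proof -
  obtain P where "finite P" "k \<le> card P" "\<forall>p\<in>P. rainbow_path \<Gamma> c u p v"
    using c uv unfolding rainbow_k_connected_def by meson
  then obtain p where p: "rainbow_path \<Gamma> c u p v"
    using \<open>k > 0\<close> by (metis card.empty equals0I not_le)
  \<comment> \<open>A single vertex is excluded by \<open>u \<noteq> v\<close>, a single edge by
    \<open>(u, v) \<notin> parcs \<Gamma>\<close>.\<close>
  obtain x w y q where [simp]: "p = x # w # y # q"
    using p uv
    by (cases p rule: vwalk_arcs.cases; cases "tl (tl p)")
       (auto simp: rainbow_path_def vpath_def vwalk_def arcs_ends_conv)
  have arcs: "(x, w) \<in> parcs \<Gamma>" "(w, y) \<in> parcs \<Gamma>" and ne: "c {x, w} \<noteq> c {w, y}"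
    using p by (auto simp: rainbow_path_def vpath_def vwalk_def arcs_ends_conv)
  have "edges \<Gamma> = (\<lambda>(x, y). {x, y}) ` parcs \<Gamma>"
    by (auto simp: edges_def)
  then have "finite (c ` edges \<Gamma>)"
    using fin by simp
  moreover have "{c {x, w}, c {w, y}} \<subseteq> c ` edges \<Gamma>"
    using arcs by (auto simp: edges_def)
  ultimately have "card {c {x, w}, c {w, y}} \<le> card (c ` edges \<Gamma>)"
    by (rule card_mono)
  then show ?thesis
    using ne by simp
qed

lemma rainbow_connectivity_eq_2:
  assumes "k > 0" "finite (parcs \<Gamma>)"
    and "u \<in> pverts \<Gamma>" "v \<in> pverts \<Gamma>" "u \<noteq> v" "(u, v) \<notin> parcs \<Gamma>"
    and c: "rainbow_k_connected k \<Gamma> c" and two: "c ` edges \<Gamma> \<subseteq> {a, b}"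
  shows "rainbow_connectivity k \<Gamma> = 2"
  unfolding rainbow_connectivity_def
proof (rule cInf_eq_minimum)
  have "card (c ` edges \<Gamma>) \<le> card {a, b}"
    using two by (intro card_mono) auto
  also have "\<dots> \<le> 2"
    by (simp add: card_insert_if)
  finally have "card (c ` edges \<Gamma>) = 2"
    using two_colors_if_rainbow_connected[OF assms(1-7)] by linarith
  then show "2 \<in> {card (c ` edges \<Gamma>) | c. rainbow_k_connected k \<Gamma> c}"
    using c by (auto intro!: exI[of _ c])
qed (use two_colors_if_rainbow_connected[OF assms(1-6)] in auto)

section \<open>Dihedral groups and their non-commuting graphs\<close>

text \<open>
  In the dihedral group of order \<open>2n\<close>, numbers below \<open>n\<close> encode rotations and \<open>n + i\<close> encodes the
  reflection given by rotating through \<open>i\<close> after a fixed reflection.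
\<close>

definition dihedral_mult :: "nat \<Rightarrow> nat \<Rightarrow> nat \<Rightarrow> nat" where
  "dihedral_mult n x y =
     nat ((int x + (if x < n then int y else - int y)) mod int n) + (if (x < n) = (y < n) then 0 else n)"

definition dihedral :: "nat \<Rightarrow> nat monoid" where
  "dihedral n = \<lparr>carrier = {..<2 * n}, monoid.mult = dihedral_mult n, one = 0\<rparr>"

lemma carrier_dihedral [simp]: "carrier (dihedral n) = {..<2 * n}"
  and mult_dihedral [simp]: "x \<otimes>\<^bsub>dihedral n\<^esub> y = dihedral_mult n x y"
  and one_dihedral [simp]: "\<one>\<^bsub>dihedral n\<^esub> = 0"
  by (simp_all add: dihedral_def)

context
  fixes n :: nat
  assumes n: "n > 0"
begin

text \<open>The offset \<open>n\<close> of reflections vanishes modulo \<open>n\<close>, so residue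
  and kind (rotation or reflection) together determine a code. This turns group identities into
  congruences of integers.\<close>

lemma dihedral_eqI:
  assumes "x < 2 * n" "y < 2 * n" "(x < n) = (y < n)" "[int x = int y] (mod int n)"
  shows "x = y"
proof -
  have "x mod n = y mod n"
    using assms(4) unfolding cong_int_iff by (simp add: cong_def)
  moreover have "z = z mod n + (if z < n then 0 else n)" if "z < 2 * n" for z
    using that by (simp add: mod_if[of z])
  ultimately show ?thesis
    using assms by metis
qed

lemma dihedral_mult_less: "dihedral_mult n x y < 2 * n"
  and dihedral_mult_less_iff: "dihedral_mult n x y < n \<longleftrightarrow> (x < n) = (y < n)"
proof -
  have "nat (z mod int n) < n" for z
    using n by (simp add: nat_less_iff)
  note * = this[of "int x + (if x < n then int y else - int y)"]
  show "dihedral_mult n x y < 2 * n" "dihedral_mult n x y < n \<longleftrightarrow> (x < n) = (y < n)"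
    unfolding dihedral_mult_def using * by auto
qed

lemma dihedral_mult_cong:
  "[int (dihedral_mult n x y) = int x + (if x < n then int y else - int y)] (mod int n)"
  using n by (auto simp: dihedral_mult_def cong_def)

lemma dihedral_mult_assoc:
  "dihedral_mult n (dihedral_mult n x y) z = dihedral_mult n x (dihedral_mult n y z)"
proof (rule dihedral_eqI)
  have "[int (dihedral_mult n (dihedral_mult n x y) z)
      = int (dihedral_mult n x y) + (if (x < n) = (y < n) then int z else - int z)] (mod int n)"
    using dihedral_mult_cong[of "dihedral_mult n x y" z] by (simp add: dihedral_mult_less_iff)
  also have "[int (dihedral_mult n x y) + (if (x < n) = (y < n) then int z else - int z)
      = int x + (if x < n then int y else - int y) + (if (x < n) = (y < n) then int z else - int z)]
      (mod int n)"
    by (intro cong_add dihedral_mult_cong cong_refl)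
  \<comment> \<open>Give rotations the sign 1 and reflections the sign -1. The sign of a product is
    the product of the signs, so the sign of \<open>x\<close> factors out.\<close>
  also have "int x + (if x < n then int y else - int y) + (if (x < n) = (y < n) then int z else - int z)
      = int x + (if x < n then 1 else - 1) * (int y + (if y < n then int z else - int z))"
    by auto
  also have "[int x + (if x < n then 1 else - 1) * (int y + (if y < n then int z else - int z))
      = int x + (if x < n then 1 else - 1) * int (dihedral_mult n y z)] (mod int n)"
    by (intro cong_add cong_mult cong_refl cong_sym[OF dihedral_mult_cong])
  also have "int x + (if x < n then 1 else - 1) * int (dihedral_mult n y z)
      = int x + (if x < n then int (dihedral_mult n y z) else - int (dihedral_mult n y z))"
    by auto
  also have "[\<dots> = int (dihedral_mult n x (dihedral_mult n y z))] (mod int n)"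
    by (rule cong_sym[OF dihedral_mult_cong])
  finally show "[int (dihedral_mult n (dihedral_mult n x y) z)
    = int (dihedral_mult n x (dihedral_mult n y z))] (mod int n)" .
qed (auto simp: dihedral_mult_less dihedral_mult_less_iff)

lemma group_dihedral: "group (dihedral n)"
proof (rule groupI)
  fix x assume "x \<in> carrier (dihedral n)"
  then have x: "x < 2 * n"
    by simp
  show "\<one>\<^bsub>dihedral n\<^esub> \<otimes>\<^bsub>dihedral n\<^esub> x = x"
    using x dihedral_mult_cong[of 0 x] n
    by (auto intro!: dihedral_eqI simp: dihedral_mult_less dihedral_mult_less_iff)
  \<comment> \<open>The inverse of \<open>x\<close>: reflections are involutions, and a rotation
    \<open>x\<close> is undone by \<open>n - x\<close>. The identity is kept apart because
    \<open>n - 0\<close> would encode a reflection.\<close>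
  define y where "y = (if 0 < x \<and> x < n then n - x else x)"
  have y: "y < 2 * n" "(y < n) = (x < n)"
    using n x by (auto simp: y_def)
  have "[int y = (if x < n then - int x else int x)] (mod int n)"
    using n by (auto simp: y_def cong_iff_dvd_diff of_nat_diff)
  then have "[int y + (if x < n then int x else - int x)
    = (if x < n then - int x else int x) + (if x < n then int x else - int x)] (mod int n)"
    by (intro cong_add cong_refl)
  then have "[int (dihedral_mult n y x) = 0] (mod int n)"
    using dihedral_mult_cong[of y x] y by (auto elim: cong_trans)
  then have "dihedral_mult n y x = 0"
    using y n by (intro dihedral_eqI) (auto simp: dihedral_mult_less dihedral_mult_less_iff)
  then show "\<exists>y\<in>carrier (dihedral n). y \<otimes>\<^bsub>dihedral n\<^esub> x = \<one>\<^bsub>dihedral n\<^esub>"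
    using y by auto
qed (use n in \<open>auto simp: dihedral_mult_less dihedral_mult_assoc\<close>)

text \<open>Unless both factors are rotations, the two products differ modulo \<open>n\<close>, up
  to sign, by twice the rotation involved or by twice the difference of the two reflections. As
  \<open>n\<close> is odd, the factor 2 cancels.\<close>

lemma dihedral_commute_iff:
  assumes "odd n" and x: "x < 2 * n" and y: "y < 2 * n"
  shows "dihedral_mult n x y = dihedral_mult n y x \<longleftrightarrow> x < n \<and> y < n \<or> x = y \<or> x = 0 \<or> y = 0"
proof -
  let ?t = "\<lambda>x y. int x + (if x < n then int y else - int y)"
  have "dihedral_mult n x y = dihedral_mult n y x \<longleftrightarrow> [?t x y = ?t y x] (mod int n)"
  proof
    assume "dihedral_mult n x y = dihedral_mult n y x"
    then show "[?t x y = ?t y x] (mod int n)"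
      using dihedral_mult_cong[of x y] dihedral_mult_cong[of y x] by (metis cong_sym cong_trans)
  next
    assume "[?t x y = ?t y x] (mod int n)"
    then have "[int (dihedral_mult n x y) = int (dihedral_mult n y x)] (mod int n)"
      using dihedral_mult_cong[of x y] dihedral_mult_cong[of y x] by (meson cong_sym cong_trans)
    then show "dihedral_mult n x y = dihedral_mult n y x"
      by (intro dihedral_eqI) (auto simp: dihedral_mult_less dihedral_mult_less_iff)
  qed
  also have "\<dots> \<longleftrightarrow> x < n \<and> y < n \<or> x = y \<or> x = 0 \<or> y = 0"
  proof -
    have double: "[2 * a = 2 * b] (mod int n) \<longleftrightarrow> [a = b] (mod int n)" for a b :: int
      using \<open>odd n\<close> by (intro cong_mult_lcancel) (simp add: coprime_commute)
    have zero: "[int z = 0] (mod int n) \<longleftrightarrow> z = 0" if "z < n" for z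
      using dihedral_eqI[of z 0] n that by auto
    consider "x < n" "y < n" | "x < n" "\<not> y < n" | "\<not> x < n" "y < n" | "\<not> x < n" "\<not> y < n"
      by blast
    then show ?thesis
    proof cases
      case 2
      then have "[?t x y = ?t y x] (mod int n) \<longleftrightarrow> [2 * int x = 2 * 0] (mod int n)"
        by (simp add: cong_iff_dvd_diff algebra_simps)
      then show ?thesis
        unfolding double using zero 2 by auto
    next
      case 3
      then have "[?t x y = ?t y x] (mod int n) \<longleftrightarrow> [2 * 0 = 2 * int y] (mod int n)"
        by (simp add: cong_iff_dvd_diff algebra_simps)
      then show ?thesis
        unfolding double using zero 3 by (auto simp: cong_sym_eq)
    next
      case 4
      then have "[?t x y = ?t y x] (mod int n) \<longleftrightarrow> [2 * int x = 2 * int y] (mod int n)"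
        by (simp add: cong_iff_dvd_diff algebra_simps)
      then show ?thesis
        unfolding double using dihedral_eqI[OF x y] 4 n by auto
    qed (auto simp: add.commute)
  qed
  finally show ?thesis .
qed

lemma group_center_dihedral:
  assumes "odd n" "n > 1"
  shows "group_center (dihedral n) = {0}"
proof -
  have "x = 0" if x: "x < 2 * n" and c: "\<forall>y<2 * n. dihedral_mult n x y = dihedral_mult n y x" for x
  proof (rule ccontr)
    assume "x \<noteq> 0"
    \<comment> \<open>A reflection commutes with a non-identity \<open>x\<close> only if it equals
      \<open>x\<close>, but \<open>n > 1\<close> provides two reflections.\<close>
    then have "x = y" if "n \<le> y" "y < 2 * n" for y
      using c dihedral_commute_iff[OF assms(1) x] that by fastforce
    then have "x = n" "x = n + 1"
      using \<open>n > 1\<close> by auto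
    then show False
      by simp
  qed
  moreover have "dihedral_mult n 0 y = dihedral_mult n y 0" if "y < 2 * n" for y
    using dihedral_commute_iff[OF assms(1) _ that, of 0] n by simp
  ultimately show ?thesis
    using n by (fastforce simp: group_center_def)
qed

lemma non_commuting_graph_dihedral:
  assumes "odd n" "n > 1"
  shows "pverts (non_commuting_graph (dihedral n)) = {1..<2 * n}"
    and "(x, y) \<in> parcs (non_commuting_graph (dihedral n)) \<longleftrightarrow>
      x \<in> {1..<2 * n} \<and> y \<in> {1..<2 * n} \<and> x \<noteq> y \<and> (n \<le> x \<or> n \<le> y)"
  using dihedral_commute_iff[OF assms(1), of x y]
  by (auto simp: non_commuting_graph_def group_center_dihedral[OF assms] simp del: One_nat_def)

end

lemma dihedral_not_comm:
  assumes "odd n" "n > 1"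
  shows "\<not> comm_group (dihedral n)"
proof
  assume "comm_group (dihedral n)"
  then have "dihedral_mult n n (n + 1) = dihedral_mult n (n + 1) n"
    using comm_groupE(4)[of "dihedral n" n "n + 1"] assms by simp
  then show False
    using dihedral_commute_iff[of n n "n + 1"] assms by simp
qed

text \<open>Isomorphic groups have the same order, here \<open>2 * m\<close> and
  \<open>2 * n\<close>.\<close>

lemma dihedral_iso_imp_eq:
  assumes "dihedral m \<cong> dihedral n"
  shows "m = n"
proof -
  obtain h where "bij_betw h {..<2 * m} {..<2 * n}"
    using assms by (auto simp: is_iso_def iso_def)
  then show ?thesis
    using bij_betw_same_card by fastforce
qed

section \<open>The board coloring and the reflections that separate two vertices\<close>

text \<open>
  The cell of \<open>x\<close> is \<open>(x mod m, x div m mod m)\<close>, both for a rotation and for a reflection, since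
  their codes differ by a multiple of \<open>m\<^sup>2\<close>.
\<close>

definition same_line :: "nat \<Rightarrow> nat \<Rightarrow> nat \<Rightarrow> bool" where
  "same_line m x y \<longleftrightarrow> x mod m = y mod m \<or> x div m mod m = y div m mod m"

text \<open>Colors live on unordered pairs, hence the quantifiers over \<open>e\<close>; the
  symmetry of \<open>same_line\<close> makes the order immaterial. The condition
  \<open>e \<subseteq> {m * m..}\<close> says that both ends are reflections.\<close>

definition board_coloring :: "nat \<Rightarrow> nat set \<Rightarrow> nat" where
  "board_coloring m e =
     of_bool (\<exists>x\<in>e. \<exists>y\<in>e. x \<noteq> y \<and> (same_line m x y \<longleftrightarrow> e \<subseteq> {m * m..}))"

lemma board_coloring_pair:
  assumes "x \<noteq> y"
  shows "board_coloring m {x, y} = of_bool (same_line m x y \<longleftrightarrow> m * m \<le> x \<and> m * m \<le> y)"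
  using assms by (auto simp: board_coloring_def same_line_def)

definition reflection_at :: "nat \<Rightarrow> nat \<Rightarrow> nat \<Rightarrow> nat" where
  "reflection_at m s t = m * m + (t * m + s)"

lemma reflection_at:
  assumes "s < m" "t < m"
  shows "m * m \<le> reflection_at m s t" "reflection_at m s t < 2 * (m * m)"
    "reflection_at m s t mod m = s" "reflection_at m s t div m mod m = t"
proof -
  have "t * m + s < Suc t * m"
    using assms by simp
  also have "\<dots> \<le> m * m"
    using assms by (intro mult_right_mono) auto
  finally show "reflection_at m s t < 2 * (m * m)"
    by (simp add: reflection_at_def)
  \<comment> \<open>The offset \<open>m * m\<close> only adds \<open>m\<close> to the quotient by
    \<open>m\<close>, which disappears modulo \<open>m\<close>.\<close>
  have eq: "reflection_at m s t = s + (m + t) * m"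
    by (simp add: reflection_at_def algebra_simps)
  show "reflection_at m s t mod m = s" "reflection_at m s t div m mod m = t"
    unfolding eq using assms by auto
qed (simp add: reflection_at_def)

text \<open>The cell holds the two base \<open>m\<close> digits of \<open>x mod (m * m)\<close>; the
  kind decides whether \<open>m * m\<close> is added.\<close>

lemma board_ext:
  fixes m x y :: nat
  assumes "x mod m = y mod m" "x div m mod m = y div m mod m"
    and "x < 2 * (m * m)" "y < 2 * (m * m)" "x < m * m \<longleftrightarrow> y < m * m"
  shows "x = y"
proof -
  have "x mod (m * m) = y mod (m * m)"
    unfolding mod_mult2_eq using assms(1,2) by simp
  moreover have "z = z mod (m * m) + (if z < m * m then 0 else m * m)" if "z < 2 * (m * m)" for z
    using that by (simp add: mod_if[of z])
  from this[OF assms(3)] this[OF assms(4)] have "x = x mod (m * m) + (if x < m * m then 0 else m * m)"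
    "y = y mod (m * m) + (if x < m * m then 0 else m * m)"
    using assms(5) by simp_all
  ultimately show ?thesis
    by linarith
qed

text \<open>Here \<open>f\<close> runs along a line of the board, and \<open>a\<close>,
  \<open>b\<close> are the positions where it may fail to separate two given vertices.\<close>

lemma card_line_ge:
  assumes "k + 2 \<le> m" "inj_on f {..<m}"
  shows "k \<le> card (f ` ({..<m} - {a, b}))"
proof -
  have "card (f ` ({..<m} - {a, b})) = card ({..<m} - {a, b})"
    using assms(2) by (intro card_image) (auto intro: inj_on_subset)
  moreover have "card {a, b} \<le> 2"
    by (simp add: card_insert_if)
  ultimately show ?thesis
    using diff_card_le_card_Diff[of "{a, b}" "{..<m}"] assms(1) by simp
qed

text \<open>For vertices of the same kind, a line through the cell of one that misses the cell of
  the other separates them. For different kinds, a line missing both cells does; it exists because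
  \<open>m\<close> is at least 3.\<close>

lemma ex_separating_reflections:
  assumes m: "k + 3 \<le> m" and x: "x < 2 * (m * m)" and y: "y < 2 * (m * m)" and "x \<noteq> y"
  obtains W where "finite W" "k \<le> card W" "W \<subseteq> {m * m..<2 * (m * m)}" "x \<notin> W" "y \<notin> W"
    "\<And>w. w \<in> W \<Longrightarrow> board_coloring m {x, w} \<noteq> board_coloring m {w, y}"
proof -
  note separating = that
  define s where "s = x mod m"
  define t where "t = x div m mod m"
  define s' where "s' = y mod m"
  define t' where "t' = y div m mod m"
  note defs = s_def t_def s'_def t'_def
  have less: "s < m" "t < m" "s' < m" "t' < m"
    using m by (simp_all add: defs)
  \<comment> \<open>As \<open>w\<close> is a reflection, an edge from \<open>x\<close> to
    \<open>w\<close> is colored by whether collinearity of the cells agrees with \<open>x\<close>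
    being a reflection.\<close>
  have col: "board_coloring m {x, w} \<noteq> board_coloring m {w, y}"
    if "(same_line m x w \<longleftrightarrow> m * m \<le> x) \<noteq> (same_line m y w \<longleftrightarrow> m * m \<le> y)"
      "w \<noteq> x" "w \<noteq> y" "m * m \<le> w" for w
    using that by (simp add: insert_commute[of w y] board_coloring_pair eq_commute[of _ w])
  have inj: "inj_on (reflection_at m r) {..<m}" "inj_on (\<lambda>q. reflection_at m q r) {..<m}"
    if "r < m" for r
    by (rule inj_onI; metis that lessThan_iff reflection_at(3,4))+
  have line: "same_line m x (reflection_at m r q) \<longleftrightarrow> s = r \<or> t = q"
    "same_line m y (reflection_at m r q) \<longleftrightarrow> s' = r \<or> t' = q" if "r < m" "q < m" for r q
    using that by (simp_all add: same_line_def reflection_at defs)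
  have ne: "reflection_at m r q \<noteq> x \<and> reflection_at m r q \<noteq> y"
    if "r < m" "q < m" "(r \<noteq> s \<and> r \<noteq> s') \<or> (q \<noteq> t \<and> q \<noteq> t')" for r q
    using that reflection_at(3,4)[of r m q] by (auto simp: defs)
  have thesis
    if "inj_on f {..<m}" and f: "\<And>i. i < m \<Longrightarrow> i \<noteq> a \<Longrightarrow> i \<noteq> b \<Longrightarrow>
        f i \<in> {m * m..<2 * (m * m)} \<and> f i \<noteq> x \<and> f i \<noteq> y \<and>
        (same_line m x (f i) \<longleftrightarrow> m * m \<le> x) \<noteq> (same_line m y (f i) \<longleftrightarrow> m * m \<le> y)" for f a b
  proof (rule separating)
    show "k \<le> card (f ` ({..<m} - {a, b}))"
      using m \<open>inj_on f {..<m}\<close> by (intro card_line_ge) auto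
    show "board_coloring m {x, w} \<noteq> board_coloring m {w, y}" if "w \<in> f ` ({..<m} - {a, b})" for w
      using that f by (intro col) auto
    show "x \<notin> f ` ({..<m} - {a, b})" "y \<notin> f ` ({..<m} - {a, b})"
      using f by blast+
    show "f ` ({..<m} - {a, b}) \<subseteq> {m * m..<2 * (m * m)}"
      using f by blast
  qed simp
  note via = this
  show thesis
  proof (cases "m * m \<le> x \<longleftrightarrow> m * m \<le> y")
    case True
    then consider "s \<noteq> s'" | "s = s'" "t \<noteq> t'"
      using board_ext[of x m y] x y \<open>x \<noteq> y\<close> by (auto simp: defs not_le[symmetric])
    then show thesis
    proof cases
      case 1
      \<comment> \<open>All cells of this line are collinear with \<open>x\<close>. Dropping
        position \<open>t'\<close> leaves none collinear with \<open>y\<close>, and dropping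
        \<open>t\<close> avoids \<open>x\<close> itself.\<close>
      show thesis
        by (rule via[OF inj(1)[OF less(1)], of t t'])
           (use 1 True less ne in \<open>auto simp: reflection_at line\<close>)
    next
      case 2
      show thesis
        by (rule via[OF inj(2)[OF less(2)], of s s'])
           (use 2 True less ne in \<open>auto simp: reflection_at line\<close>)
    qed
  next
    case False
    \<comment> \<open>Here the coloring rule is negated for exactly one of \<open>x\<close> and \<open>y\<close>, so cells collinear with
      neither of them separate them, even if both have the same cell.\<close>
    have "\<not> {..<m} \<subseteq> {s, s'}"
      using card_mono[of "{s, s'}" "{..<m}"] m by (auto simp: card_insert_if split: if_splits)
    then obtain r where r: "r < m" "r \<noteq> s" "r \<noteq> s'"
      by auto
    show thesis
      by (rule via[OF inj(1)[OF r(1)], of t t'])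
         (use r False less ne in \<open>auto simp: reflection_at line\<close>)
  qed
qed

section \<open>The dihedral groups of order \<open>2 * (m * m)\<close>\<close>

lemma dihedral_square_rainbow:
  assumes "k > 0" "odd m" "k + 3 \<le> m"
  defines "\<Gamma> \<equiv> non_commuting_graph (dihedral (m * m))"
  shows "k \<le> vertex_connectivity \<Gamma>" "rainbow_connectivity k \<Gamma> = 2"
proof -
  have "4 * 4 \<le> m * m"
    using assms by (intro mult_mono) auto
  then have big: "2 < m * m" and "odd (m * m)"
    using assms by auto
  have "m * 1 \<le> m * m"
    using assms by (intro mult_left_mono) auto
  then have kmm: "k < m * m"
    using assms(3) by linarith
  have V: "pverts \<Gamma> = {1..<2 * (m * m)}" and
    E: "\<And>x y. (x, y) \<in> parcs \<Gamma> \<longleftrightarrow> x \<in> {1..<2 * (m * m)} \<and> y \<in> {1..<2 * (m * m)} \<and> x \<noteq> y \<and>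
          (m * m \<le> x \<or> m * m \<le> y)"
    unfolding \<Gamma>_def using non_commuting_graph_dihedral[of "m * m"] \<open>odd (m * m)\<close> big by auto
  show "k \<le> vertex_connectivity \<Gamma>"
    by (rule vertex_connectivity_ge_if_dominating_set[of _ "{m * m..<2 * (m * m)}"])
       (use V E kmm big in auto)
  interpret pair_graph \<Gamma>
    unfolding \<Gamma>_def by (rule pair_graph_non_commuting_graph) simp
  have "rainbow_k_connected k \<Gamma> (board_coloring m)"
  proof (rule rainbow_k_connected_via)
    fix u v assume uv: "u \<in> pverts \<Gamma>" "v \<in> pverts \<Gamma>" "u \<noteq> v"
    then obtain W where W: "finite W" "k \<le> card W" "W \<subseteq> {m * m..<2 * (m * m)}" "u \<notin> W" "v \<notin> W"
      "\<And>w. w \<in> W \<Longrightarrow> board_coloring m {u, w} \<noteq> board_coloring m {w, v}"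
      using ex_separating_reflections[OF assms(3), of u v] V by auto
    have "rainbow_path \<Gamma> (board_coloring m) u [u, w, v] v" if "w \<in> W" for w
    proof -
      have "w \<in> {m * m..<2 * (m * m)}" "w \<noteq> u" "w \<noteq> v"
        using W that by auto
      then show ?thesis
        using uv W(6)[OF that] big by (intro rainbow_path_via) (auto simp: V E)
    qed
    then show "\<exists>W. finite W \<and> k \<le> card W \<and> u \<notin> W \<and> v \<notin> W \<and>
        (\<forall>w\<in>W. rainbow_path \<Gamma> (board_coloring m) u [u, w, v] v)"
      using W by blast
  qed
  then show "rainbow_connectivity k \<Gamma> = 2"
    \<comment> \<open>By \<open>big\<close>, 1 and 2 are distinct nontrivial rotations, hence
      non-adjacent vertices.\<close>
    using V E big assms(1)
    by (intro rainbow_connectivity_eq_2[where u = 1 and v = 2 and c = "board_coloring m" and a = 0 and b = 1])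
       (auto simp: board_coloring_def)
qed

theorem theorem1p2:
  fixes k :: nat
  assumes "k > 0"
  shows "\<exists>\<G> :: nat monoid set.
           infinite \<G> \<and>
           (\<forall>G \<in> \<G>. \<forall>H \<in> \<G>. G \<noteq> H \<longrightarrow> \<not> G \<cong> H) \<and>
           (\<forall>G \<in> \<G>. group G \<and> finite (carrier G) \<and> \<not> comm_group G \<and>
              k \<le> vertex_connectivity (non_commuting_graph G) \<and>
              rainbow_connectivity k (non_commuting_graph G) = 2)"
proof -
  \<comment> \<open>Each such \<open>m\<close> contributes one group; different \<open>m\<close>
    give different orders, so the family is infinite and pairwise non-isomorphic.\<close>
  define M where "M = {m. odd m \<and> k + 3 \<le> m}"
  have "\<exists>m>b. m \<in> M" for b
    by (rule exI[of _ "2 * (b + k + 3) + 1"]) (simp add: M_def)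
  then have "infinite M"
    by (simp add: infinite_nat_iff_unbounded)
  moreover have "inj_on (\<lambda>m. dihedral (m * m)) M"
  proof (rule inj_onI)
    fix m m' assume "dihedral (m * m) = dihedral (m' * m')"
    then have "m * m = m' * m'"
      using carrier_dihedral by (metis lessThan_eq_iff mult_left_cancel zero_neq_numeral)
    then show "m = m'"
      by (simp flip: power2_eq_square)
  qed
  ultimately have "infinite ((\<lambda>m. dihedral (m * m)) ` M)"
    by (simp add: finite_image_iff)
  moreover have "group (dihedral (m * m)) \<and> \<not> comm_group (dihedral (m * m))" if "m \<in> M" for m
  proof -
    have "4 * 1 \<le> m * m"
      using that assms by (intro mult_le_mono) (auto simp: M_def)
    moreover have "odd (m * m)"
      using that by (simp add: M_def)
    ultimately show ?thesis
      using group_dihedral[of "m * m"] dihedral_not_comm[of "m * m"] by auto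
  qed
  ultimately show ?thesis
    using dihedral_square_rainbow[OF assms]
    by (intro exI[of _ "(\<lambda>m. dihedral (m * m)) ` M"]) (auto simp: M_def dest: dihedral_iso_imp_eq)
qed

end
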